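(* Let $\alpha$ be an ordinal, and let $G=\bigoplus_{i\in\aleph_\alpha}\mathbb{Q}$ be the direct sum of copies of $\mathbb{Q}$ indexed by the (well-ordered set) $\aleph_\alpha$, made into a totally ordered abelian group by declaring a nonzero element $r=(r_i)_{i\in\aleph_\alpha}\in G$ to be positive, $r>0$, if and only if $r_j>0$ in $\mathbb{Q}$, where $j$ is the least element of the support $\{i\in\aleph_\alpha \mid r_i\neq 0\}$. Let $D$ be a valuation domain with valuation group $G$. Then the following statements hold. (1) If $\aleph_\alpha$ is a regular cardinal, then $D$ is a strictly $(<\aleph_\alpha^{+})$-noetherian domain. (2) If $\aleph_\alpha$ is a singular cardinal, then $D$ is a strictly $(<\aleph_\alpha)$-noetherian domain.
   Context: Cardinals: for a cardinal $\kappa$, $\kappa^+$ denotes the least cardinal greater than $\kappa$. An infinite cardinal $\kappa$ is regular if $\mathrm{cf}(\kappa)=\kappa$ and singular if $\mathrm{cf}(\kappa)<\kappa$, where $\mathrm{cf}$ denotes cofinality. The cardinal $\aleph_\alpha$ is identified with the corresponding initial ordinal, hence is a well-ordered set. The cardinal $\aleph_\alpha$ is a successor cardinal if $\alpha$ is a successor ordinal, and a limit cardinal otherwise. Valuation domains: let $(G,+,\le)$ be a totally ordered abelian group and $Q$ a field, and let $\infty$ be a symbol not in $G$ with $x<\infty$ and $x+\infty=\infty$ for all $x\in G$. A valuation map is a map $v:Q\to G\cup\{\infty\}$ such that $v(0)=\infty$, $v(xy)=v(x)+v(y)$ and $v(x+y)\ge\min\{v(x),v(y)\}$ for all $x,y\in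 Q$. An integral domain $D$ with quotient field $Q$ is a valuation domain if for all $x,y\in D$ either $x\mid y$ or $y\mid x$; equivalently, $D=\{r\in Q\mid v(r)\ge 0\}$ for some valuation map $v:Q\to G\cup\{\infty\}$. The group $G$ is called the valuation group of $D$ when $D=\{r\in Q\mid v(r)\ge 0\}$ for a surjective valuation map $v:Q\to G\cup\{\infty\}$. Parametrized noetherian rings: rings are associative with unity and ideals are left ideals (for the commutative domain $D$ these are the usual ideals). Let $\kappa$ be an infinite cardinal. An ideal $I$ of a ring $R$ is $(<\kappa)$-generated if there are a cardinal $\mu<\kappa$ and a family $\{a_i\mid i<\mu\}\subseteq I$ that generates $I$ as an ideal. A ring $R$ is (left) $(<\kappa)$-noetherian if every ideal of $R$ is $(<\kappa)$-generated. Let $\gamma(R)$ be the minimum infinite cardinal such that every ideal of $R$ is $(<\gamma(R))$-generated. The ring $R$ is (left) strictly $(<\kappa)$-noetherian if $\gamma(R)=\kappa$. For uncountable $\kappa$ (the only case relevant here) this means that every ideal of $R$ is $(<\kappa)$-generated and: if $\kappa$ is a limit cardinal, then for every cardinal $\mu<\kappa$ there is an ideal of $R$ that is not $(<\mu^+)$-generated; if $\kappa=\lambda^+$ is a successor cardinal, then there is an ideal of $R$ that is $(<\lambda^+)$-generated but not $(<\lambda)$-generated. *)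

theory Defs
  imports
    "HOL.Hull"
    "HOL-Library.Poly_Mapping"
    "HOL-Computational_Algebra.Polynomial_Factorial"
begin

unbundle cardinal_syntax

definition ord_of :: "'i::wellorder itself \<Rightarrow> 'i rel" where
  "ord_of _ = {(x, y). x \<le> y}"

text \<open>
  An element x of an initial ordinal \<kappa> is itself an infinite cardinal iff the initial segment
  below x is one.  \<open>is_aleph \<alpha> \<kappa>\<close> says that \<kappa> is the \<alpha>-th infinite cardinal (counting from 0),
  i.e. the infinite cardinals strictly below \<kappa> have order type \<alpha>.
\<close>
definition is_aleph :: "'o rel \<Rightarrow> 'k rel \<Rightarrow> bool" where
  "is_aleph \<alpha> \<kappa> \<longleftrightarrow>
     Cinfinite \<kappa> \<and> \<alpha> =o Restr \<kappa> {x \<in> Field \<kappa>. Cinfinite (Restr \<kappa> (underS \<kappa> x))}"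

lemma ex_is_aleph:
  fixes \<kappa> :: "'k rel"
  assumes "Cinfinite \<kappa>"
  shows "\<exists>\<alpha> :: 'k rel. is_aleph \<alpha> \<kappa>"
proof -
  have "Well_order (Restr \<kappa> A)" for A
    by (rule Well_order_Restr, rule card_order_on_well_order_on, use assms in simp)
  then show ?thesis
    unfolding is_aleph_def using assms ordIso_reflexive by blast
qed

text \<open>
  The library's \<^const>\<open>regularCard\<close> says that every cofinal subset of \<kappa> has cardinality \<kappa>,
  i.e. cf \<kappa> = \<kappa>.  The following is cf \<kappa> < \<kappa>.
\<close>
definition singularCard :: "'k rel \<Rightarrow> bool" where
  "singularCard \<kappa> \<longleftrightarrow> (\<exists>K \<subseteq> Field \<kappa>. cofinal K \<kappa> \<and> |K| <o \<kappa>)"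

definition left_ideal :: "'r::ring_1 set \<Rightarrow> bool" where
  "left_ideal I \<longleftrightarrow>
     0 \<in> I \<and> (\<forall>x\<in>I. \<forall>y\<in>I. x + y \<in> I) \<and> (\<forall>r. \<forall>x\<in>I. r * x \<in> I)"

text \<open>
  Every cardinal below \<open>\<kappa> :: 'k rel\<close> is order isomorphic to an initial segment of \<kappa>, so letting
  \<mu> range over the cardinals on the same type \<open>'k\<close> loses nothing, here and in \<open>is_gamma\<close>.
\<close>
definition lt_generated :: "'k rel \<Rightarrow> 'r::ring_1 set \<Rightarrow> bool" where
  "lt_generated \<kappa> I \<longleftrightarrow>
     (\<exists>\<mu> :: 'k rel. Card_order \<mu> \<and> \<mu> <o \<kappa> \<and>
        (\<exists>a :: 'k \<Rightarrow> 'r. a ` Field \<mu> \<subseteq> I \<and> left_ideal hull (a ` Field \<mu>) = I))"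

definition lt_noetherian :: "'k rel \<Rightarrow> 'r::ring_1 itself \<Rightarrow> bool" where
  "lt_noetherian \<kappa> _ \<longleftrightarrow> (\<forall>I :: 'r set. left_ideal I \<longrightarrow> lt_generated \<kappa> I)"

text \<open>
  \<open>is_gamma TYPE('r) \<kappa>\<close> means \<open>\<gamma>(R) = \<kappa>\<close> for the ring \<open>R\<close> of all elements of type \<open>'r\<close>.
\<close>
definition is_gamma :: "'r::ring_1 itself \<Rightarrow> 'k rel \<Rightarrow> bool" where
  "is_gamma R \<kappa> \<longleftrightarrow>
     Cinfinite \<kappa> \<and> lt_noetherian \<kappa> R \<and>
     (\<forall>\<mu> :: 'k rel. Cinfinite \<mu> \<and> lt_noetherian \<mu> R \<longrightarrow> \<kappa> \<le>o \<mu>)"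

definition strictly_lt_noetherian :: "'k rel \<Rightarrow> 'r::ring_1 itself \<Rightarrow> bool" where
  "strictly_lt_noetherian \<kappa> R \<longleftrightarrow> is_gamma R \<kappa>"

datatype 'g with_infinity = Fin 'g | Infty  (\<open>\<infinity>\<close>)

instantiation with_infinity :: (ab_group_add) comm_monoid_add
begin

definition zero_with_infinity :: "'a with_infinity" where
  "0 = Fin 0"

fun plus_with_infinity :: "'a with_infinity \<Rightarrow> 'a with_infinity \<Rightarrow> 'a with_infinity" where
  "Fin x + Fin y = Fin (x + y)"
| "\<infinity> + y = \<infinity>"
| "x + \<infinity> = \<infinity>"

instance
proof
  fix x y z :: "'a with_infinity"
  show "x + y + z = x + (y + z)"
    by (cases x; cases y; cases z) (simp_all add: add.assoc)
  show "x + y = y + x"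
    by (cases x; cases y) (simp_all add: add.commute)
  show "0 + x = x"
    by (cases x) (simp_all add: zero_with_infinity_def)
qed

end

instantiation with_infinity :: (linorder) linorder
begin

fun less_eq_with_infinity :: "'a with_infinity \<Rightarrow> 'a with_infinity \<Rightarrow> bool" where
  "Fin x \<le> Fin y \<longleftrightarrow> x \<le> y"
| "x \<le> \<infinity> \<longleftrightarrow> True"
| "\<infinity> \<le> Fin y \<longleftrightarrow> False"

definition less_with_infinity :: "'a with_infinity \<Rightarrow> 'a with_infinity \<Rightarrow> bool" where
  "x < y \<longleftrightarrow> x \<le> y \<and> \<not> y \<le> (x :: 'a with_infinity)"

instance
proof
  fix x y z :: "'a with_infinity"
  show "x < y \<longleftrightarrow> x \<le> y \<and> \<not> y \<le> x"
    by (fact less_with_infinity_def)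
  show "x \<le> x"
    by (cases x) simp_all
  show "x \<le> y \<Longrightarrow> y \<le> z \<Longrightarrow> x \<le> z"
    by (cases x; cases y; cases z) simp_all
  show "x \<le> y \<Longrightarrow> y \<le> x \<Longrightarrow> x = y"
    by (cases x; cases y) simp_all
  show "x \<le> y \<or> y \<le> x"
    by (cases x; cases y) auto
qed

end

definition valuation_map :: "('q::field \<Rightarrow> 'g::linordered_ab_group_add with_infinity) \<Rightarrow> bool" where
  "valuation_map v \<longleftrightarrow>
     v 0 = \<infinity> \<and>
     (\<forall>x y. v (x * y) = v x + v y) \<and>
     (\<forall>x y. v (x + y) \<ge> min (v x) (v y))"

definition valuation_domain :: "'d::idom itself \<Rightarrow> bool" where
  "valuation_domain _ \<longleftrightarrow> (\<forall>x y :: 'd. x dvd y \<or> y dvd x)"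

text \<open>
  The domain \<open>D\<close> is the type \<open>'d\<close>, its quotient field is \<^typ>\<open>'d fract\<close>, into which \<open>D\<close> is embedded
  by \<^const>\<open>to_fract\<close>.
\<close>
definition has_valuation_group ::
    "'d::idom itself \<Rightarrow> 'g::linordered_ab_group_add itself \<Rightarrow> bool" where
  "has_valuation_group _ _ \<longleftrightarrow>
     (\<exists>v :: 'd fract \<Rightarrow> 'g with_infinity.
        valuation_map v \<and> surj v \<and> range (to_fract :: 'd \<Rightarrow> 'd fract) = {r. v r \<ge> 0})"

text \<open>
  The direct sum of copies of the rationals indexed by \<open>'i\<close> is \<^typ>\<open>'i \<Rightarrow>\<^sub>0 rat\<close>; its library order
  is the one determined by the least element of the support.
\<close>
lemma direct_sum_pos_iff:
  fixes r :: "'i::wellorder \<Rightarrow>\<^sub>0 rat"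
  assumes "r \<noteq> 0"
  shows "r > 0 \<longleftrightarrow> Poly_Mapping.lookup r (LEAST i. i \<in> Poly_Mapping.keys r) > 0"
proof -
  define j where "j = (LEAST i. i \<in> Poly_Mapping.keys r)"
  have "\<exists>i. Poly_Mapping.lookup r i \<noteq> 0"
    using assms by (auto simp: poly_mapping_eq_iff fun_eq_iff)
  then obtain i where "i \<in> Poly_Mapping.keys r"
    unfolding in_keys_iff by blast
  then have "j \<in> Poly_Mapping.keys r"
    unfolding j_def by (rule LeastI)
  then have j: "Poly_Mapping.lookup r j \<noteq> 0"
    by (simp add: in_keys_iff)
  have below: "Poly_Mapping.lookup r k = 0" if "k < j" for k
    using not_less_Least[of k "\<lambda>i. i \<in> Poly_Mapping.keys r"] that by (simp add: j_def in_keys_iff)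
  have "r > 0 \<longleftrightarrow> (\<exists>k. 0 < Poly_Mapping.lookup r k \<and> (\<forall>k' < k. Poly_Mapping.lookup r k' = 0))"
    by (simp add: less_poly_mapping.rep_eq less_fun_def eq_commute[of 0])
  also have "\<dots> \<longleftrightarrow> Poly_Mapping.lookup r j > 0"
  proof
    assume "\<exists>k. 0 < Poly_Mapping.lookup r k \<and> (\<forall>k' < k. Poly_Mapping.lookup r k' = 0)"
    then obtain k where k: "0 < Poly_Mapping.lookup r k" "\<forall>k' < k. Poly_Mapping.lookup r k' = 0"
      by blast
    have "\<not> j < k"
      using k(2) j by blast
    moreover have "\<not> k < j"
      using k(1) below by force
    ultimately show "Poly_Mapping.lookup r j > 0"
      using k(1) by (simp add: not_less antisym)
  qed (use below in blast)
  finally show ?thesis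
    by (simp add: j_def)
qed

end

theory Submission
  imports Defs "HOL-Library.Countable"
begin

text \<open>
  Write \<open>\<kappa>\<close> for \<open>\<aleph>\<^sub>\<alpha>\<close>. In a valuation domain an ideal is determined by the upward closed set of
  the values of its nonzero elements, and a subset generates it iff the values of the nonzero elements
  of this subset are coinitial in that set. So \<open>\<gamma>(D)\<close> is governed by the coinitialities of the
  upward closed sets of nonnegative elements of \<open>G\<close>.

  Upper bound: \<open>G\<close> has only \<open>\<kappa>\<close> elements (\<open>card_poly_mapping_le\<close>), so \<open>\<kappa>\<close> generators always suffice.
  The coinitiality of a linear order is \<open>0\<close>, \<open>1\<close> or a regular cardinal; hence if \<open>\<kappa>\<close> is singular,
  fewer than \<open>\<kappa>\<close> generators suffice (\<open>singular_coinitial_subset\<close>).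

  Lower bound: the unit vectors of \<open>G\<close> form a strictly decreasing chain of positive elements indexed
  by \<open>\<kappa>\<close>. Let \<open>\<nu> \<le> \<kappa>\<close> be a regular cardinal, viewed as an initial segment of \<open>\<kappa>\<close>. The
  elements of \<open>D\<close> whose value is at least some unit vector with index in \<open>\<nu>\<close> form an ideal, and a
  set of generators of it yields a cofinal subset of \<open>\<nu>\<close>, so has at least \<open>\<nu>\<close> elements
  (\<open>lt_noetherian_gt_regular\<close>). For regular \<open>\<kappa>\<close> the choice \<open>\<nu> = \<kappa>\<close> shows \<open>\<gamma>(D) \<ge> \<kappa>\<^sup>+\<close>. For singular
  \<open>\<kappa>\<close> and an infinite \<open>\<mu> < \<kappa>\<close> the choice \<open>\<nu> = \<mu>\<^sup>+\<close>, a successor and hence regular,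
  shows that \<open>D\<close> is not \<open>(<\<mu>)\<close>-noetherian.
\<close>

section \<open>Cardinal arithmetic\<close>

text \<open>
  A finitely supported function with at most \<open>n + 1\<close> nonzero entries is one with at most \<open>n\<close> of them
  plus a multiple of a unit vector. So the set of those with at most \<open>n\<close> entries is bounded by
  induction on \<open>n\<close>, and the whole type is a countable union of such sets.
\<close>
lemma card_poly_mapping_le:
  fixes \<kappa> :: "'k rel"
  assumes "Cinfinite \<kappa>" and "|UNIV :: 'i set| \<le>o \<kappa>" and "|UNIV :: 'b set| \<le>o \<kappa>"
  shows "|UNIV :: ('i \<Rightarrow>\<^sub>0 'b::ab_group_add) set| \<le>o \<kappa>"
proof -
  define A :: "nat \<Rightarrow> ('i \<Rightarrow>\<^sub>0 'b) set" where "A n = {g. card (Poly_Mapping.keys g) \<le> n}" for n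
  have "|A n| \<le>o \<kappa>" for n
  proof (induction n)
    case 0
    have "A 0 = {0}"
      by (auto simp: A_def)
    then show ?case
      using assms(1) by (metis Cfinite_ordLess_Cinfinite card_of_Card_order cfinite_def
          Field_card_of finite.emptyI finite.insertI ordLess_imp_ordLeq)
  next
    case (Suc n)
    let ?f = "\<lambda>(g, i, b). g + Poly_Mapping.single i b :: 'i \<Rightarrow>\<^sub>0 'b"
    have "A (Suc n) \<subseteq> ?f ` (A n \<times> UNIV \<times> UNIV)"
    proof
      fix g assume g: "g \<in> A (Suc n)"
      show "g \<in> ?f ` (A n \<times> UNIV \<times> UNIV)"
      proof (cases "g = 0")
        case True
        then show ?thesis
          by (intro image_eqI[of _ _ "(0, undefined, 0)"]) (auto simp: A_def)
      next
        case False
        then obtain i where i: "i \<in> Poly_Mapping.keys g"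
          by fastforce
        define h where "h = g - Poly_Mapping.single i (Poly_Mapping.lookup g i)"
        have "Poly_Mapping.keys h \<subseteq> Poly_Mapping.keys g - {i}"
          by (auto simp: h_def in_keys_iff lookup_minus lookup_single when_def split: if_splits)
        then have "card (Poly_Mapping.keys h) \<le> card (Poly_Mapping.keys g - {i})"
          by (intro card_mono) auto
        also have "\<dots> \<le> n"
          using i g by (simp add: A_def)
        finally have "h \<in> A n"
          by (simp add: A_def)
        then show ?thesis
          by (intro image_eqI[of _ _ "(h, i, Poly_Mapping.lookup g i)"]) (auto simp: h_def)
      qed
    qed
    moreover have "|A n \<times> (UNIV :: 'i set) \<times> (UNIV :: 'b set)| \<le>o \<kappa>"
      using assms Suc by (intro card_of_Times_ordLeq_infinite_Field) (auto simp: cinfinite_def)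
    ultimately show ?case
      by (meson card_of_image card_of_mono1 ordLeq_transitive)
  qed
  moreover have "|UNIV :: nat set| \<le>o \<kappa>"
    using assms(1) by (metis card_of_nat natLeq_ordLeq_cinfinite ordIso_ordLeq_trans)
  ultimately have "|\<Union>n. A n| \<le>o \<kappa>"
    using assms(1) by (intro UNION_Cinfinite_bound) auto
  moreover have "(\<Union>n. A n) = UNIV"
    by (auto simp: A_def)
  ultimately show ?thesis
    by simp
qed

text \<open>
  A direct form of the fact that a coinitiality is never a singular cardinal. A cofinal subset of \<open>\<kappa>\<close>
  smaller than \<open>\<kappa>\<close> writes \<open>U\<close> as a union of fewer than \<open>\<kappa>\<close> sets, each smaller than \<open>\<kappa>\<close>. Either one of these is
  already coinitial, or below each of them lies an element of \<open>U\<close>, and these elements are coinitial.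
\<close>
lemma singular_coinitial_subset:
  fixes \<kappa> :: "'k rel" and U :: "'u::linorder set"
  assumes "Cinfinite \<kappa>" and "singularCard \<kappa>" and "|U| \<le>o \<kappa>"
  obtains C where "C \<subseteq> U" and "|C| <o \<kappa>" and "\<And>u. u \<in> U \<Longrightarrow> \<exists>c\<in>C. c \<le> u"
proof -
  have "|U| \<le>o |Field \<kappa>|"
    using assms by (meson card_of_Field_ordIso ordIso_symmetric ordLeq_ordIso_trans)
  then obtain h where h: "inj_on h U" "h ` U \<subseteq> Field \<kappa>"
    by (metis card_of_ordLeq)
  obtain K where K: "K \<subseteq> Field \<kappa>" "cofinal K \<kappa>" "|K| <o \<kappa>"
    using assms(2) by (auto simp: singularCard_def)
  define L where "L k = {u \<in> U. h u \<in> underS \<kappa> k}" for k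
  have small: "|L k| <o \<kappa>" if "k \<in> K" for k
  proof -
    have "inj_on h (L k)" and "\<And>u. u \<in> L k \<Longrightarrow> h u \<in> underS \<kappa> k"
      using h(1) by (auto simp: L_def intro: inj_on_subset)
    then have "|L k| \<le>o |underS \<kappa> k|"
      by (rule card_of_ordLeqI)
    also have "|underS \<kappa> k| <o \<kappa>"
      using assms(1) K(1) that by (intro card_of_underS) auto
    finally show ?thesis .
  qed
  have cover: "\<exists>k\<in>K. u \<in> L k" if "u \<in> U" for u
  proof -
    have "h u \<in> Field \<kappa>"
      using h(2) that by blast
    then obtain k where "k \<in> K" "h u \<noteq> k" "(h u, k) \<in> \<kappa>"
      using K(2) unfolding cofinal_def by blast
    then show ?thesis
      using that by (auto simp: L_def underS_def)
  qed
  show thesis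
  proof (cases "\<exists>k\<in>K. \<forall>u\<in>U. \<exists>c\<in>L k. c \<le> u")
    case True
    then obtain k where k: "k \<in> K" "\<And>u. u \<in> U \<Longrightarrow> \<exists>c\<in>L k. c \<le> u"
      by blast
    have "L k \<subseteq> U"
      by (auto simp: L_def)
    then show thesis
      using small[OF k(1)] k(2) by (rule that)
  next
    case False
    then have "\<forall>k\<in>K. \<exists>u. u \<in> U \<and> (\<forall>c\<in>L k. u < c)"
      by (fastforce simp: not_le)
    then obtain b where b: "\<And>k. k \<in> K \<Longrightarrow> b k \<in> U" "\<And>k c. k \<in> K \<Longrightarrow> c \<in> L k \<Longrightarrow> b k < c"
      by (auto dest!: bchoice)
    show thesis
    proof (rule that[of "b ` K"])
      show "|b ` K| <o \<kappa>"
        using K(3) card_of_image ordLeq_ordLess_trans by blast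
      show "\<exists>c\<in>b ` K. c \<le> u" if "u \<in> U" for u
        using cover[OF that] b(2) by (blast intro: less_imp_le)
    qed (use b in auto)
  qed
qed

section \<open>Divisibility and ideals\<close>

text \<open>
  Everything about ideals depends on divisibility in the domain alone. Restricting the valuation
  from the quotient field to the domain retains just this information: the value decides
  divisibility, and every nonnegative value is attained.
\<close>
lemma valuation_of_divisibility:
  assumes "has_valuation_group TYPE('d::idom) TYPE('g::linordered_ab_group_add)"
  obtains w :: "'d::idom \<Rightarrow> 'g::linordered_ab_group_add with_infinity"
  where "\<And>x y. x dvd y \<longleftrightarrow> w x \<le> w y" and "range w = {\<gamma>. 0 \<le> \<gamma>}"
proof -
  obtain v :: "'d fract \<Rightarrow> 'g with_infinity"
    where v: "valuation_map v" "surj v" "range (to_fract :: 'd \<Rightarrow> 'd fract) = {r. v r \<ge> 0}"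
    using assms by (auto simp: has_valuation_group_def)
  have v0: "v 0 = \<infinity>" and vmult: "\<And>x y. v (x * y) = v x + v y"
    using v(1) by (auto simp: valuation_map_def)
  have v1: "v 1 = 0"
  proof -
    obtain x where "v x = 0"
      using v(2) by (metis surjD)
    then show ?thesis
      using vmult[of x 1] by simp
  qed
  have finite_val: "\<exists>g. v x = Fin g" if "x \<noteq> 0" for x
    using vmult[of x "1 / x"] v1 that by (cases "v x") (auto simp: zero_with_infinity_def)
  define w where "w x = v (to_fract x)" for x :: 'd
  have nonneg: "0 \<le> w x" for x
    using v(3) by (auto simp: w_def)
  have "x dvd y \<longleftrightarrow> w x \<le> w y" for x y
  proof
    assume "x dvd y"
    then obtain z where "y = x * z" ..
    then have "w y = w x + w z"
      by (simp add: w_def vmult)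
    then show "w x \<le> w y"
      using nonneg[of z] by (cases "w x"; cases "w z") (auto simp: zero_with_infinity_def)
  next
    assume le: "w x \<le> w y"
    show "x dvd y"
    proof (cases "x = 0")
      case True
      then have "w y = \<infinity>"
        using le v0 by (cases "w y") (auto simp: w_def)
      then have "y = 0"
        using finite_val[of "to_fract y"] by (auto simp: w_def)
      then show ?thesis
        by simp
    next
      case False
      define q where "q = to_fract y / to_fract x"
      have y: "to_fract y = to_fract x * q"
        using False by (simp add: q_def)
      obtain g where g: "w x = Fin g"
        using finite_val[of "to_fract x"] False by (auto simp: w_def)
      have "0 \<le> v q"
        using le vmult[of "to_fract x" q] y g
        by (cases "v q") (auto simp: w_def zero_with_infinity_def)
      then obtain z where "q = to_fract z"
        using v(3) by blast
      then have "y = x * z"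
        using y by (metis to_fract_eq_iff to_fract_mult)
      then show ?thesis
        by simp
    qed
  qed
  moreover have "range w = {\<gamma>. 0 \<le> \<gamma>}"
  proof -
    have "range w = v ` range to_fract"
      by (auto simp: w_def)
    also have "\<dots> = {\<gamma>. 0 \<le> \<gamma>}"
      using v(2) unfolding v(3) by (auto simp: image_iff)
    finally show ?thesis .
  qed
  ultimately show thesis
    by (rule that)
qed

text \<open>
  A sum of two multiples of generators is a multiple of the one generator that divides the other, so
  no linear combinations are needed. The \<open>0\<close> is inserted for the case of an empty \<open>S\<close>, which
  generates the zero ideal.
\<close>
lemma left_ideal_hull_valuation_domain:
  assumes "valuation_domain TYPE('d::idom)"
  shows "left_ideal hull (S :: 'd set) = {y. \<exists>x\<in>insert 0 S. x dvd y}"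
proof (rule hull_unique)
  show "left_ideal {y. \<exists>x\<in>insert 0 S. x dvd y}"
    unfolding left_ideal_def
  proof (intro conjI ballI allI)
    fix y z assume "y \<in> {y. \<exists>x\<in>insert 0 S. x dvd y}" "z \<in> {y. \<exists>x\<in>insert 0 S. x dvd y}"
    then obtain a b where ab: "a \<in> insert 0 S" "a dvd y" "b \<in> insert 0 S" "b dvd z"
      by blast
    consider "a dvd b" | "b dvd a"
      using assms by (auto simp: valuation_domain_def)
    then show "y + z \<in> {y. \<exists>x\<in>insert 0 S. x dvd y}"
      using ab by cases (blast intro: dvd_add dvd_trans)+
  qed (auto intro: dvd_mult)
next
  fix t :: "'d set" assume "S \<subseteq> t" "left_ideal t"
  then show "{y. \<exists>x\<in>insert 0 S. x dvd y} \<subseteq> t"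
    unfolding left_ideal_def dvd_def by (auto simp: mult.commute) (metis mult.commute subsetD)
qed (auto intro: dvd_refl)

text \<open>
  Replaces families indexed by a cardinal on the type of \<open>\<kappa>\<close> by sets of generators: a set of
  cardinality below \<open>\<kappa>\<close> has an injective copy on that type, which serves as the index set.
\<close>
lemma lt_generated_iff:
  fixes \<kappa> :: "'k rel" and I :: "'r::ring_1 set"
  assumes "Card_order \<kappa>"
  shows "lt_generated \<kappa> I \<longleftrightarrow> (\<exists>S\<subseteq>I. |S| <o \<kappa> \<and> left_ideal hull S = I)"
proof
  assume "lt_generated \<kappa> I"
  then obtain \<mu> :: "'k rel" and a :: "'k \<Rightarrow> 'r" where \<mu>: "Card_order \<mu>" "\<mu> <o \<kappa>"
    and a: "a ` Field \<mu> \<subseteq> I" "left_ideal hull (a ` Field \<mu>) = I"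
    unfolding lt_generated_def by blast
  have "|a ` Field \<mu>| <o \<kappa>"
    using \<mu> by (meson card_of_Field_ordIso card_of_image ordIso_ordLess_trans ordLeq_ordLess_trans)
  then show "\<exists>S\<subseteq>I. |S| <o \<kappa> \<and> left_ideal hull S = I"
    using a by blast
next
  assume "\<exists>S\<subseteq>I. |S| <o \<kappa> \<and> left_ideal hull S = I"
  then obtain S where S: "S \<subseteq> I" "|S| <o \<kappa>" "left_ideal hull S = I"
    by blast
  have "|S| \<le>o |Field \<kappa>|"
    using S(2) assms by (meson card_of_Field_ordIso ordIso_symmetric ordLess_imp_ordLeq
        ordLeq_ordIso_trans)
  then obtain h :: "'r \<Rightarrow> 'k" where h: "inj_on h S"
    by (metis card_of_ordLeq)
  have "|h ` S| <o \<kappa>"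
    using S(2) card_of_image ordLeq_ordLess_trans by blast
  moreover have "inv_into S h ` Field |h ` S| = S"
    using h by (simp add: Field_card_of)
  ultimately show "lt_generated \<kappa> I"
    unfolding lt_generated_def using S card_of_Card_order
    by (intro exI[of _ "|h ` S|"] conjI exI[of _ "inv_into S h"]) auto
qed

lemma generated_of_coinitial_values:
  fixes \<kappa> :: "'k rel" and w :: "'d::idom \<Rightarrow> 'v::linorder"
  assumes "valuation_domain TYPE('d)" and "\<And>x y. x dvd y \<longleftrightarrow> w x \<le> w y"
    and "Card_order \<kappa>" and "left_ideal I"
    and "C \<subseteq> w ` I" and "|C| <o \<kappa>" and "\<And>u. u \<in> w ` I \<Longrightarrow> \<exists>c\<in>C. c \<le> u"
  shows "lt_generated \<kappa> I"
proof -
  obtain S where S: "S \<subseteq> I" "C = w ` S" "inj_on w S"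
    using assms(5) by (metis subset_image_inj)
  have "|S| <o \<kappa>"
    using S assms(6) by (metis card_of_ordIsoI inj_on_imp_bij_betw ordIso_ordLess_trans)
  moreover have "left_ideal hull S = I"
  proof (rule antisym)
    show "left_ideal hull S \<subseteq> I"
      using S(1) assms(4) by (rule hull_minimal)
    show "I \<subseteq> left_ideal hull S"
      unfolding left_ideal_hull_valuation_domain[OF assms(1)]
      using assms(2,7) S(2) by fastforce
  qed
  ultimately show ?thesis
    using S(1) lt_generated_iff[OF assms(3)] by blast
qed

section \<open>Ideals that need many generators\<close>

text \<open>On unit vectors the order of \<open>G\<close> reverses that of the index set: the least index decides the sign.\<close>
lemma single_one_le_iff:
  fixes i j :: "'i::linorder"
  shows "Poly_Mapping.single i (1::rat) \<le> Poly_Mapping.single j 1 \<longleftrightarrow> j \<le> i"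
proof -
  have less: "Poly_Mapping.single i (1::rat) < Poly_Mapping.single j 1" if "j < i" for i j :: 'i
    using that by (auto simp: less_poly_mapping.rep_eq less_fun_def lookup_single when_def
        intro!: exI[of _ j])
  show ?thesis
    using less[of i j] less[of j i] by (metis leD leI le_less)
qed

text \<open>
  The ideal is \<open>I = {d. \<exists>a\<in>\<nu>. w d \<ge> e\<^sub>a}\<close> with \<open>e\<^sub>a\<close> the unit vector at \<open>a\<close>. Each generator has a
  value \<open>\<ge> e\<^sub>a\<close> for some \<open>a\<close>. Since each element of value \<open>e\<^sub>b\<close> with \<open>b \<in> \<nu>\<close> is a multiple of a generator,
  the indices chosen for the generators are cofinal in \<open>\<nu>\<close>, and regularity counts them.
\<close>
lemma lt_noetherian_gt_regular:
  fixes \<nu> :: "'l rel" and \<mu> :: "'k rel"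
  assumes "valuation_domain TYPE('d::idom)"
    and "has_valuation_group TYPE('d) TYPE('i::wellorder \<Rightarrow>\<^sub>0 rat)"
    and "Cinfinite \<nu>" and "regularCard \<nu>" and "\<nu> \<le>o ord_of TYPE('i)"
    and "Card_order \<mu>" and "lt_noetherian \<mu> TYPE('d)"
  shows "\<nu> <o \<mu>"
proof -
  obtain w :: "'d \<Rightarrow> ('i \<Rightarrow>\<^sub>0 rat) with_infinity"
    where w: "\<And>x y. x dvd y \<longleftrightarrow> w x \<le> w y" and range_w: "range w = {\<gamma>. 0 \<le> \<gamma>}"
    using valuation_of_divisibility[OF assms(2)] by blast
  have wo: "Well_order \<nu>"
    using assms(3) by (auto simp: card_order_on_well_order_on)
  obtain f where f: "embed \<nu> (ord_of TYPE('i)) f"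
    using assms(5) by (auto simp: ordLeq_def)
  have f_mono: "f a \<le> f b" if "(a, b) \<in> \<nu>" for a b
    using embed_compat[OF f] that by (auto simp: compat_def ord_of_def)
  have f_reflect: "(a, b) \<in> \<nu>" if "a \<in> Field \<nu>" "b \<in> Field \<nu>" "f a \<le> f b" for a b
  proof -
    have "(a, b) \<in> \<nu> \<or> (b, a) \<in> \<nu>"
      using wo that by (metis wo_rel.TOTALS wo_rel_def)
    moreover have "a = b" if "(b, a) \<in> \<nu>"
      using embed_inj_on[OF wo f] f_mono[OF that] \<open>f a \<le> f b\<close> \<open>a \<in> _\<close> \<open>b \<in> _\<close>
      by (meson antisym inj_onD)
    ultimately show ?thesis
      by blast
  qed
  define e where "e a = Fin (Poly_Mapping.single (f a) (1::rat))" for a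
  have e_le_iff: "e a \<le> e b \<longleftrightarrow> f b \<le> f a" for a b
    by (simp add: e_def single_one_le_iff)
  define I where "I = {d. \<exists>a\<in>Field \<nu>. e a \<le> w d}"
  have w0: "w 0 = \<infinity>"
  proof -
    obtain x where "w x = \<infinity>"
      using range_w by (metis (mono_tags) less_eq_with_infinity.simps(2) mem_Collect_eq imageE)
    then show ?thesis
      using w[of x 0] by (cases "w 0") auto
  qed
  have "Field \<nu> \<noteq> {}"
    using assms(3) by (auto simp: cinfinite_def)
  then have "left_ideal I"
    unfolding left_ideal_def
  proof (intro conjI ballI allI)
    fix x y assume "x \<in> I" "y \<in> I"
    moreover have "x dvd x + y \<or> y dvd x + y"
      using assms(1) by (metis dvd_add dvd_refl valuation_domain_def)
    ultimately show "x + y \<in> I"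
      unfolding I_def w by (blast intro: order_trans)
  next
    fix r x assume "x \<in> I"
    then show "r * x \<in> I"
      unfolding I_def using w[of x "r * x"] by (auto intro: order_trans)
  qed (auto simp: I_def w0)
  then obtain S where S: "S \<subseteq> I" "|S| <o \<mu>" "left_ideal hull S = I"
    using assms(6,7) by (auto simp: lt_noetherian_def lt_generated_iff)
  obtain k where k: "\<And>x. x \<in> S \<Longrightarrow> k x \<in> Field \<nu>" "\<And>x. x \<in> S \<Longrightarrow> e (k x) \<le> w x"
  proof -
    have "\<forall>x\<in>S. \<exists>a. a \<in> Field \<nu> \<and> e a \<le> w x"
      using S(1) by (auto simp: I_def)
    then show thesis
      using that by (auto dest!: bchoice)
  qed
  have "cofinal (k ` S) \<nu>"
    unfolding cofinal_def
  proof
    fix a assume a: "a \<in> Field \<nu>"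
    \<comment> \<open>The definition of cofinality asks for an index strictly above \<open>a\<close>, so the generator is taken
      of value at most \<open>e b\<close> for some \<open>b\<close> strictly above \<open>a\<close>.\<close>
    then obtain b where b: "b \<in> Field \<nu>" "a \<noteq> b" "(a, b) \<in> \<nu>"
      using infinite_Card_order_limit assms(3) by (metis cinfinite_def)
    have "0 \<le> e b"
      by (auto simp: e_def zero_with_infinity_def less_eq_poly_mapping.rep_eq le_fun_def
          less_fun_def lookup_single when_def)
    then obtain d where d: "w d = e b"
      using range_w by (metis (mono_tags) mem_Collect_eq imageE)
    then have "d \<in> I"
      using b(1) by (auto simp: I_def)
    then obtain x where x: "x \<in> insert 0 S" "w x \<le> e b"
      using S(3) unfolding left_ideal_hull_valuation_domain[OF assms(1)] w d[symmetric] by blast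
    then have "x \<in> S"
      using w0 by (auto simp: e_def)
    then have "e (k x) \<le> e b"
      using k(2) x(2) by (blast intro: order_trans)
    then have "(b, k x) \<in> \<nu>"
      using f_reflect b(1) k(1) \<open>x \<in> S\<close> by (simp add: e_le_iff)
    then have "a \<noteq> k x \<and> (a, k x) \<in> \<nu>"
      using b wo by (metis wo_rel.ANTISYM wo_rel.TRANS wo_rel_def antisymD transD)
    then show "\<exists>b\<in>k ` S. a \<noteq> b \<and> (a, b) \<in> \<nu>"
      using \<open>x \<in> S\<close> by blast
  qed
  then have "|k ` S| =o \<nu>"
    using assms(4) k(1) unfolding regularCard_def by blast
  then have "\<nu> \<le>o |S|"
    by (meson card_of_image ordIso_ordLeq_trans ordIso_symmetric)
  then show ?thesis
    using S(2) ordLeq_ordLess_trans by blast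
qed

section \<open>Regular and singular alephs\<close>

theorem theorem2p7:
  fixes \<alpha> :: "'o rel"
  assumes "Well_order \<alpha>"
    and "is_aleph \<alpha> (ord_of TYPE('i::wellorder))"
    and "valuation_domain TYPE('d::idom)"
    and "has_valuation_group TYPE('d) TYPE('i \<Rightarrow>\<^sub>0 rat)"
  shows "(regularCard (ord_of TYPE('i)) \<longrightarrow>
           strictly_lt_noetherian (cardSuc (ord_of TYPE('i))) TYPE('d)) \<and>
         (singularCard (ord_of TYPE('i)) \<longrightarrow>
           strictly_lt_noetherian (ord_of TYPE('i)) TYPE('d))"
proof -
  let ?\<kappa> = "ord_of TYPE('i)"
  have inf: "Cinfinite ?\<kappa>"
    using assms(2) by (simp add: is_aleph_def)
  have Field: "Field ?\<kappa> = UNIV"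
    by (auto simp: ord_of_def Field_def)
  have iso: "|UNIV :: 'i set| =o ?\<kappa>"
    using card_of_Field_ordIso[of ?\<kappa>] inf by (simp add: Field)
  obtain w :: "'d \<Rightarrow> ('i \<Rightarrow>\<^sub>0 rat) with_infinity"
    where w: "\<And>x y. x dvd y \<longleftrightarrow> w x \<le> w y" and "range w = {\<gamma>. 0 \<le> \<gamma>}"
    using valuation_of_divisibility[OF assms(4)] by blast
  have card_values: "|w ` I| \<le>o ?\<kappa>" for I
  proof -
    have "|UNIV :: rat set| \<le>o |UNIV :: nat set|"
      using card_of_ordLeq[of "UNIV :: rat set" "UNIV :: nat set"]
      by (metis ex_inj subset_UNIV)
    then have "|UNIV :: rat set| \<le>o ?\<kappa>"
      using inf by (meson card_of_nat natLeq_ordLeq_cinfinite ordIso_ordLeq_trans ordLeq_transitive)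
    then have "|UNIV :: ('i \<Rightarrow>\<^sub>0 rat) set| \<le>o ?\<kappa>"
      by (rule card_poly_mapping_le[OF inf ordIso_imp_ordLeq[OF iso]])
    then have "|range (Fin :: ('i \<Rightarrow>\<^sub>0 rat) \<Rightarrow> _)| \<le>o ?\<kappa>"
      using card_of_image ordLeq_transitive by blast
    moreover have "|{\<infinity> :: ('i \<Rightarrow>\<^sub>0 rat) with_infinity}| \<le>o ?\<kappa>"
      using inf by (metis Cfinite_ordLess_Cinfinite card_of_Card_order cfinite_def
          Field_card_of finite.emptyI finite.insertI ordLess_imp_ordLeq)
    ultimately have "|range (Fin :: ('i \<Rightarrow>\<^sub>0 rat) \<Rightarrow> _) \<union> {\<infinity>}| \<le>o ?\<kappa>"
      using inf by (rule Un_Cinfinite_bound)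
    moreover have "w ` I \<subseteq> range Fin \<union> {\<infinity>}"
      by (metis Un_iff insertI1 rangeI subsetI with_infinity.exhaust)
    ultimately show ?thesis
      using card_of_mono1 ordLeq_transitive by blast
  qed
  show ?thesis
  proof (intro conjI impI)
    assume regular: "regularCard ?\<kappa>"
    have "lt_generated (cardSuc ?\<kappa>) I" if "left_ideal I" for I :: "'d set"
    proof (rule generated_of_coinitial_values[OF assms(3) w _ that])
      show "|w ` I| <o cardSuc ?\<kappa>"
        using card_values inf cardSuc_greater ordLeq_ordLess_trans by blast
    qed (use inf Cinfinite_cardSuc in blast)+
    moreover have "cardSuc ?\<kappa> \<le>o \<mu>"
      if "Cinfinite \<mu> \<and> lt_noetherian \<mu> TYPE('d)" for \<mu> :: "'i set rel"
      using lt_noetherian_gt_regular[OF assms(3,4) inf regular] that inf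
      by (meson cardSuc_least card_order_on_well_order_on ordLeq_reflexive)
    ultimately show "strictly_lt_noetherian (cardSuc ?\<kappa>) TYPE('d)"
      using Cinfinite_cardSuc[OF inf]
      by (simp add: strictly_lt_noetherian_def is_gamma_def lt_noetherian_def)
  next
    assume singular: "singularCard ?\<kappa>"
    have "lt_generated ?\<kappa> I" if I: "left_ideal I" for I :: "'d set"
    proof -
      obtain C where "C \<subseteq> w ` I" "|C| <o ?\<kappa>" "\<And>u. u \<in> w ` I \<Longrightarrow> \<exists>c\<in>C. c \<le> u"
        using singular_coinitial_subset[OF inf singular card_values] by blast
      then show ?thesis
        using generated_of_coinitial_values[OF assms(3) w _ I] inf by blast
    qed
    moreover have "?\<kappa> \<le>o \<mu>"
      if \<mu>: "Cinfinite \<mu> \<and> lt_noetherian \<mu> TYPE('d)" for \<mu> :: "'i rel"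
    proof (rule ccontr)
      \<comment> \<open>\<open>\<mu>\<close> itself may be singular; its successor is regular and still at most \<open>\<kappa>\<close>.\<close>
      assume "\<not> ?\<kappa> \<le>o \<mu>"
      then have "\<mu> <o ?\<kappa>"
        using inf \<mu> by (simp add: card_order_on_well_order_on not_ordLeq_iff_ordLess)
      then have "cardSuc \<mu> \<le>o ?\<kappa>"
        using inf \<mu> cardSuc_least by blast
      then have "cardSuc \<mu> <o \<mu>"
        using lt_noetherian_gt_regular[OF assms(3,4)] \<mu> Cinfinite_cardSuc regularCard_cardSuc
        by blast
      then show False
        using \<mu> cardSuc_greater not_ordLess_ordLeq ordLess_imp_ordLeq by blast
    qed
    ultimately show "strictly_lt_noetherian ?\<kappa> TYPE('d)"
      using inf by (simp add: strictly_lt_noetherian_def is_gamma_def lt_noetherian_def)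
  qed
qed

end
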